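(* Let $\sigma:\mathbb{R}^n\to\mathbb{R}^{n\times m}$ be of class $C^2$ and let $u:\mathbb{R}^n\to\mathbb{R}$ be of class $C^3$. Let $\bar x\in\mathbb{R}^n$ be a point such that $\nabla u(\bar x)\ne0$ and $\nabla u(\bar x)\,\sigma(\bar x)=0$. Then $K(\bar x)$ is positive semidefinite if and only if $S(\bar x)$ is symmetric and positive semidefinite. In particular, if it is not the case that $S(\bar x)$ is both symmetric and positive semidefinite, then $K(\bar x)$ has a negative eigenvalue and the target $\mathcal T=\{x:u(x)\le u(\bar x)\}$ is STLA at $\bar x$ for the symmetric system $\dot x_t=\sigma(x_t)a_t$ with controls valued in $B_1(0)=\{a\in\mathbb{R}^m:|a|\le1\}$.
   Context: Controls $a_\cdot:[0,+\infty)\to B_1(0)$ are piecewise constant (finitely many pieces on bounded intervals); trajectories are solutions of the system on their maximal interval of existence. $\mathcal T$ is small time locally attainable (STLA) at $\bar x$ if for every $t>0$ the point $\bar x$ is interior to the set of points from which $\mathcal T$ can be reached in time less than $t$ along trajectories of the system. Here $\nabla u\,\sigma$ is the vector function with components $\nabla u\cdot\sigma_i$, $i=1,\dots,m$, with $\sigma_i$ the columns of $\sigma$. Define the $m\times m$ matrix $S(x)=D(\nabla u\,\sigma)(x)\,\sigma(x)$, that is $S_{i,j}(x)=\nabla(\nabla u\cdot\sigma_i)(x)\cdot\sigma_j(x)$; let $S^*=\frac12(S+{}^tS)$. Define the symmetric $2m\times2m$ matrix $$K(x)=\begin{pmatrix}S^*(x)&{}^tS(x)\\S(x)&S^*(x)\end{pmatrix}.$$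 *)

theory Defs
  imports "HOL-Analysis.Analysis"
begin

text \<open>Functions of class \<open>C\<^sup>k\<close> on the whole space. Since the domain is finite dimensional,
  continuity of every directional derivative \<open>x \<mapsto> f'(x) v\<close> is the same as continuity of
  the derivative itself.\<close>

fun Ck :: "nat \<Rightarrow> ('a::euclidean_space \<Rightarrow> 'b::real_normed_vector) \<Rightarrow> bool" where
  "Ck 0 f \<longleftrightarrow> continuous_on UNIV f"
| "Ck (Suc k) f \<longleftrightarrow>
     (\<forall>x. f differentiable (at x)) \<and> (\<forall>v. Ck k (\<lambda>x. frechet_derivative f (at x) v))"

definition grad :: "(real^'n \<Rightarrow> real) \<Rightarrow> real^'n \<Rightarrow> real^'n" where
  "grad u x = (\<chi> k. frechet_derivative u (at x) (axis k 1))"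

text \<open>A matrix field \<open>\<sigma>\<close> with \<open>n\<close> rows and \<open>m\<close> columns has type \<open>real^'n \<Rightarrow> real^'m^'n\<close>;
  component \<open>i\<close> of \<open>grad_mult u \<sigma> x\<close> is the inner product of \<open>grad u x\<close> with column \<open>i\<close> of
  \<open>\<sigma> x\<close>.\<close>

definition grad_mult :: "(real^'n \<Rightarrow> real) \<Rightarrow> (real^'n \<Rightarrow> real^'m^'n) \<Rightarrow> real^'n \<Rightarrow> real^'m" where
  "grad_mult u \<sigma> x = grad u x v* \<sigma> x"

definition S_mat :: "(real^'n \<Rightarrow> real) \<Rightarrow> (real^'n \<Rightarrow> real^'m^'n) \<Rightarrow> real^'n \<Rightarrow> real^'m^'m" where
  "S_mat u \<sigma> x = jacobian (grad_mult u \<sigma>) (at x) ** \<sigma> x"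

definition sym_part :: "real^'m^'m \<Rightarrow> real^'m^'m" where
  "sym_part A = (1/2) *\<^sub>R (A + transpose A)"

text \<open>Two-by-two block matrices, indexed by the sum type: \<open>Inl\<close> is the first block of
  indices and \<open>Inr\<close> the second.\<close>

definition block_mat ::
  "real^'m^'m \<Rightarrow> real^'m^'m \<Rightarrow> real^'m^'m \<Rightarrow> real^'m^'m \<Rightarrow> real^('m+'m)^('m+'m)" where
  "block_mat A B C D = (\<chi> p q.
     (case p of
        Inl i \<Rightarrow> (case q of Inl j \<Rightarrow> A $ i $ j | Inr j \<Rightarrow> B $ i $ j)
      | Inr i \<Rightarrow> (case q of Inl j \<Rightarrow> C $ i $ j | Inr j \<Rightarrow> D $ i $ j)))"

definition K_mat ::
  "(real^'n \<Rightarrow> real) \<Rightarrow> (real^'n \<Rightarrow> real^'m^'n) \<Rightarrow> real^'n \<Rightarrow> real^('m+'m)^('m+'m)" where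
  "K_mat u \<sigma> x =
     (let S = S_mat u \<sigma> x in
      block_mat (sym_part S) (transpose S) S (sym_part S))"

definition symmetric_mat :: "real^'m^'m \<Rightarrow> bool" where
  "symmetric_mat A \<longleftrightarrow> transpose A = A"

text \<open>Positive semidefiniteness does not include symmetry; symmetry of \<open>S_mat\<close> is always
  required separately, and \<open>K_mat\<close> is symmetric by construction.\<close>

definition pos_semidef :: "real^'m^'m \<Rightarrow> bool" where
  "pos_semidef A \<longleftrightarrow> (\<forall>v. 0 \<le> v \<bullet> (A *v v))"

lemma symmetric_K_mat: "symmetric_mat (K_mat u \<sigma> x)"
  by (auto simp: symmetric_mat_def K_mat_def Let_def block_mat_def sym_part_def transpose_def
      vec_eq_iff split: sum.splits)

definition is_eigenvalue :: "real^'m^'m \<Rightarrow> real \<Rightarrow> bool" where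
  "is_eigenvalue A l \<longleftrightarrow> (\<exists>v. v \<noteq> 0 \<and> A *v v = l *\<^sub>R v)"

text \<open>Controls are considered on \<open>[0, \<infinity>)\<close> only; values at negative times are irrelevant. On each
  \<open>[0, T]\<close> the finite set \<open>P\<close> contains the switching times, where the value of the control is
  free (in the unit ball).\<close>

definition is_control :: "(real \<Rightarrow> real^'m) \<Rightarrow> bool" where
  "is_control a \<longleftrightarrow>
     (\<forall>t\<ge>0. a t \<in> cball 0 1) \<and>
     (\<forall>T\<ge>0. \<exists>P. finite P \<and>
        (\<forall>I. is_interval I \<and> I \<subseteq> {0..T} - P \<longrightarrow> a constant_on I))"

text \<open>A solution of \<open>x' = f x a\<close> on an interval \<open>J\<close> starting at time \<open>0\<close>: continuous, and
  satisfying the equation except at finitely many times of each bounded interval.\<close>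

definition is_solution ::
  "(real^'n \<Rightarrow> real^'m \<Rightarrow> real^'n) \<Rightarrow> (real \<Rightarrow> real^'m) \<Rightarrow> real set \<Rightarrow> (real \<Rightarrow> real^'n) \<Rightarrow> bool" where
  "is_solution f a J x \<longleftrightarrow>
     is_interval J \<and> 0 \<in> J \<and> J \<subseteq> {0..} \<and> continuous_on J x \<and>
     (\<forall>T\<ge>0. \<exists>P. finite P \<and>
        (\<forall>t \<in> J \<inter> {0..T} - P. (x has_vector_derivative f (x t) (a t)) (at t within J)))"

definition is_trajectory ::
  "(real^'n \<Rightarrow> real^'m \<Rightarrow> real^'n) \<Rightarrow> (real \<Rightarrow> real^'m) \<Rightarrow> real set \<Rightarrow> (real \<Rightarrow> real^'n) \<Rightarrow> bool" where
  "is_trajectory f a J x \<longleftrightarrow>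
     is_solution f a J x \<and>
     (\<forall>J' y. is_solution f a J' y \<and> J \<subseteq> J' \<and> (\<forall>t\<in>J. y t = x t) \<longrightarrow> J' = J)"

definition reach_within ::
  "(real^'n \<Rightarrow> real^'m \<Rightarrow> real^'n) \<Rightarrow> (real^'n) set \<Rightarrow> real \<Rightarrow> (real^'n) set" where
  "reach_within f \<T> t =
     {x0. \<exists>a J x. is_control a \<and> is_trajectory f a J x \<and> x 0 = x0 \<and>
        (\<exists>s\<in>J. s < t \<and> x s \<in> \<T>)}"

definition STLA ::
  "(real^'n \<Rightarrow> real^'m \<Rightarrow> real^'n) \<Rightarrow> (real^'n) set \<Rightarrow> real^'n \<Rightarrow> bool" where
  "STLA f \<T> p \<longleftrightarrow> (\<forall>t>0. p \<in> interior (reach_within f \<T> t))"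

end

theory Submission
  imports Defs
begin

text \<open>
  The link between the matrix \<open>K\<close> and the dynamics is a second-order expansion. Apply a constant
  control \<open>v\<close> for time \<open>s\<close> and then a constant control \<open>w\<close> for time \<open>s\<close>. Since the first-order
  term vanishes at the given point, \<open>u\<close> changes there by \<open>s\<^sup>2 / 2\<close> times
  \<open>v \<bullet> S v + w \<bullet> S w + 2 (w \<bullet> S v)\<close>, up to \<open>o(s\<^sup>2)\<close>, and this is the quadratic form of \<open>K\<close>
  at \<open>(v, w)\<close> (\<open>quadratic_form_K_mat\<close>).

  The equivalence is linear algebra (\<open>pos_semidef_K_mat_iff\<close>): for symmetric \<open>S\<close> the form is
  \<open>(v + w) \<bullet> S (v + w)\<close>, while a positive semidefinite \<open>K\<close> must annihilate every \<open>(v, -v)\<close>, where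
  its form is zero, and this forces \<open>S\<close> to be symmetric. The negative eigenvalue is the minimum
  of the form on the unit sphere.

  For attainability (\<open>STLA_if_not_pos_semidef\<close>) take \<open>(v, w)\<close> with a negative value of the form. For
  each small fixed \<open>s\<close> the two legs lower \<open>u\<close> from the given point by a definite amount.
  The same estimate, with constants uniform over a ball, holds from every nearby starting point up to
  the first-order term and the difference of the values of \<open>u\<close>, both of which are small by continuity;
  hence all nearby points enter the target by time \<open>2 s\<close>. Existence of the legs for a time uniform
  over starting points is Picard's theorem (\<open>integral_curve_in_cball\<close>). After the second leg the
  control is switched to \<open>0\<close>, so the solution lives on all of \<open>{0..}\<close> and is a maximal one.
\<close>

section \<open>Quadratic forms and the block matrix\<close>

text \<open>With \<open>w = f v\<close>, the quadratic form of \<open>f\<close> at \<open>v - e w\<close> is \<open>- 2 e |w|\<^sup>2 + O(e\<^sup>2)\<close>, which is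
negative for small \<open>e > 0\<close> unless \<open>w = 0\<close>.\<close>

lemma selfadjoint_nonneg_null:
  fixes f :: "'a::real_inner \<Rightarrow> 'a"
  assumes "linear f" and sym: "\<And>x y. x \<bullet> f y = f x \<bullet> y"
    and nonneg: "\<And>x. 0 \<le> x \<bullet> f x" and null: "v \<bullet> f v = 0"
  shows "f v = 0"
proof (rule ccontr)
  assume "f v \<noteq> 0"
  interpret linear f by fact
  define w where "w = f v"
  define c where "c = w \<bullet> f w"
  \<comment> \<open>Any positive \<open>e\<close> with \<open>e * c < 2 * (w \<bullet> w)\<close> would do; the \<open>1 +\<close> covers \<open>c = 0\<close>.\<close>
  define e where "e = (w \<bullet> w) / (1 + c)"
  have c: "0 \<le> c" unfolding c_def by (rule nonneg)
  have w: "0 < w \<bullet> w" using \<open>f v \<noteq> 0\<close> by (simp add: w_def)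
  have e: "0 < e" using c w by (simp add: e_def)
  have "(v - e *\<^sub>R w) \<bullet> f (v - e *\<^sub>R w) = e * (e * c - 2 * (w \<bullet> w))"
    using null sym[of v w]
    by (simp add: diff scaleR inner_diff_left inner_diff_right inner_commute w_def c_def
        algebra_simps)
  then have "0 \<le> e * c - 2 * (w \<bullet> w)"
    using nonneg[of "v - e *\<^sub>R w"] e by (simp add: zero_le_mult_iff)
  moreover have "e * c \<le> w \<bullet> w"
    using c w by (simp add: e_def field_simps)
  ultimately show False using w by linarith
qed

lemma inner_symmetric_mat:
  assumes "symmetric_mat A"
  shows "x \<bullet> (A *v y) = (A *v x) \<bullet> y"
  using assms by (metis dot_lmul_matrix symmetric_mat_def transpose_matrix_vector)

text \<open>The minimum \<open>l\<close> of the quadratic form on the unit sphere is an eigenvalue: \<open>A - l I\<close> is positive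
semidefinite and its form vanishes at a minimizer, which is therefore in its kernel.\<close>

lemma negative_eigenvalue:
  fixes A :: "real^'k^'k"
  assumes sym: "symmetric_mat A" and "\<not> pos_semidef A"
  shows "\<exists>l<0. is_eigenvalue A l"
proof -
  obtain z where z: "z \<bullet> (A *v z) < 0"
    using assms(2) by (auto simp: pos_semidef_def not_le)
  have cont: "continuous_on (sphere 0 1) (\<lambda>v. v \<bullet> (A *v v))"
    by (intro continuous_intros linear_continuous_on matrix_vector_mul_bounded_linear)
  have "sphere (0 :: real^'k) 1 \<noteq> {}"
    by simp
  then obtain p where p: "p \<in> sphere 0 1"
      and min: "\<And>v. v \<in> sphere 0 1 \<Longrightarrow> p \<bullet> (A *v p) \<le> v \<bullet> (A *v v)"
    using continuous_attains_inf[OF compact_sphere _ cont] by blast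
  define l where "l = p \<bullet> (A *v p)"
  have pp: "p \<bullet> p = 1" using p by (simp add: dot_square_norm)
  have bound: "l * (v \<bullet> v) \<le> v \<bullet> (A *v v)" for v
  proof (cases "v = 0")
    case False
    define r where "r = norm v"
    have r: "0 < r" using False by (simp add: r_def)
    have "l \<le> (v /\<^sub>R r) \<bullet> (A *v (v /\<^sub>R r))"
      unfolding l_def using r by (intro min) (simp add: r_def)
    also have "\<dots> = (v \<bullet> (A *v v)) / r\<^sup>2"
      by (simp add: matrix_vector_mult_scaleR power2_eq_square divide_inverse algebra_simps)
    finally show ?thesis using r by (simp add: r_def dot_square_norm field_simps)
  qed simp
  have "A *v p - l *\<^sub>R p = 0"
  proof (rule selfadjoint_nonneg_null[where f = "\<lambda>v. A *v v - l *\<^sub>R v"])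
    show "x \<bullet> (A *v y - l *\<^sub>R y) = (A *v x - l *\<^sub>R x) \<bullet> y" for x y
      by (simp add: inner_diff_left inner_diff_right inner_symmetric_mat[OF sym])
    show "linear (\<lambda>v. A *v v - l *\<^sub>R v)"
      by (intro linear_compose_sub matrix_vector_mul_linear linear_scaleR)
  qed (use pp bound in \<open>simp_all add: inner_diff_right l_def\<close>)
  moreover have "p \<noteq> 0" using pp by auto
  ultimately have "is_eigenvalue A l" by (auto simp: is_eigenvalue_def)
  moreover have "l < 0"
  proof (rule ccontr)
    assume "\<not> l < 0"
    then have "0 \<le> l * (z \<bullet> z)" by simp
    then show False using bound[of z] z by linarith
  qed
  ultimately show ?thesis by blast
qed

definition vec_join :: "real^'m \<Rightarrow> real^'m \<Rightarrow> real^('m+'m)" where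
  "vec_join v w = (\<chi> p. case p of Inl i \<Rightarrow> v $ i | Inr i \<Rightarrow> w $ i)"

lemma vec_join_cases: obtains v w where "z = vec_join v w"
proof
  show "z = vec_join (\<chi> i. z $ Inl i) (\<chi> i. z $ Inr i)"
    by (simp add: vec_join_def vec_eq_iff split: sum.split)
qed

lemma vec_join_eq_0: "vec_join v w = 0 \<longleftrightarrow> v = 0 \<and> w = 0"
  by (auto simp: vec_join_def vec_eq_iff split: sum.splits)

lemma sum_UNIV_sum_type:
  "(\<Sum>p\<in>UNIV. f p) = (\<Sum>i\<in>(UNIV::'a::finite set). f (Inl i)) + (\<Sum>j\<in>(UNIV::'b::finite set). f (Inr j))"
  by (simp flip: UNIV_Plus_UNIV add: sum.Plus)

lemma inner_vec_join: "vec_join v w \<bullet> vec_join v' w' = v \<bullet> v' + w \<bullet> w'"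
  by (simp add: inner_vec_def sum_UNIV_sum_type vec_join_def)

lemma block_mat_vec_join:
  "block_mat A B C D *v vec_join v w = vec_join (A *v v + B *v w) (C *v v + D *v w)"
  by (simp add: vec_eq_iff matrix_vector_mult_def sum_UNIV_sum_type vec_join_def block_mat_def
      split: sum.split)

lemma sym_part_mult: "sym_part A *v v = (1/2) *\<^sub>R (A *v v + v v* A)"
  by (simp add: sym_part_def scaleR_matrix_vector_assoc[symmetric] matrix_vector_mult_add_rdistrib)

text \<open>At a point where \<open>grad_mult u \<sigma>\<close> vanishes and \<open>S\<close> is the value of \<open>S_mat u \<sigma>\<close>, the change of \<open>u\<close>
after moving with control \<open>v\<close> for time \<open>s\<close> and then with control \<open>w\<close> for time \<open>s\<close> is
\<open>s\<^sup>2 / 2\<close> times this form, up to \<open>o(s\<^sup>2)\<close>. The mixed term has no factor \<open>1/2\<close> in the expansion because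
the whole first leg shifts the starting slope of the second one.\<close>

definition two_leg_form :: "real^'m^'m \<Rightarrow> real^'m \<Rightarrow> real^'m \<Rightarrow> real" where
  "two_leg_form S v w = v \<bullet> (S *v v) + w \<bullet> (S *v w) + 2 * (w \<bullet> (S *v v))"

lemma quadratic_form_K_mat:
  fixes u :: "real^'n \<Rightarrow> real" and \<sigma> :: "real^'n \<Rightarrow> real^'m^'n"
  shows "vec_join v w \<bullet> (K_mat u \<sigma> x *v vec_join v w) = two_leg_form (S_mat u \<sigma> x) v w"
proof -
  have "v \<bullet> (w v* S) = w \<bullet> (S *v v)" "v \<bullet> (v v* S) = v \<bullet> (S *v v)" "w \<bullet> (w v* S) = w \<bullet> (S *v w)"
    for S :: "real^'m^'m"
    by (metis dot_lmul_matrix inner_commute)+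
  then show ?thesis
    by (simp add: K_mat_def Let_def block_mat_vec_join inner_vec_join sym_part_mult
      two_leg_form_def inner_add_right)
qed

text \<open>If \<open>S\<close> is symmetric, the form of \<open>K\<close> at \<open>(v, w)\<close> is that of \<open>S\<close> at \<open>v + w\<close>. Conversely, the form
of \<open>K\<close> at \<open>(v, v)\<close> is four times that of \<open>S\<close> at \<open>v\<close>, and it vanishes at \<open>(v, -v)\<close>; if \<open>K\<close> is
positive semidefinite then \<open>(v, -v)\<close> is in its kernel, and the first block row of that equation
says that \<open>S\<close> and its transpose agree at \<open>v\<close>.\<close>

lemma pos_semidef_K_mat_iff:
  fixes u :: "real^'n \<Rightarrow> real" and \<sigma> :: "real^'n \<Rightarrow> real^'m^'n"
  shows "pos_semidef (K_mat u \<sigma> x) \<longleftrightarrow> symmetric_mat (S_mat u \<sigma> x) \<and> pos_semidef (S_mat u \<sigma> x)"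
  (is "?K \<longleftrightarrow> ?sym \<and> ?psd")
proof
  define S where "S = S_mat u \<sigma> x"
  assume K: ?K
  have form: "0 \<le> two_leg_form S v w" for v w
    using K unfolding pos_semidef_def S_def quadratic_form_K_mat[symmetric] by blast
  have ?psd
    unfolding pos_semidef_def S_def[symmetric]
  proof
    fix v show "0 \<le> v \<bullet> (S *v v)" using form[of v v] by (simp add: two_leg_form_def)
  qed
  moreover have ?sym
  proof -
    have "S *v v = transpose S *v v" for v
    proof -
      have "K_mat u \<sigma> x *v vec_join v (- v) = 0"
      proof (rule selfadjoint_nonneg_null[where f = "\<lambda>z. K_mat u \<sigma> x *v z"])
        show "vec_join v (- v) \<bullet> (K_mat u \<sigma> x *v vec_join v (- v)) = 0"
          by (simp add: quadratic_form_K_mat two_leg_form_def linear_neg[OF matrix_vector_mul_linear])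
      qed (use K in \<open>auto simp: inner_symmetric_mat[OF symmetric_K_mat] pos_semidef_def\<close>)
      then have "(1/2) *\<^sub>R (S *v v + v v* S) = v v* S"
        by (simp add: K_mat_def Let_def block_mat_vec_join sym_part_mult vec_join_eq_0
            linear_neg[OF matrix_vector_mul_linear] S_def flip: transpose_matrix_vector)
      then have "2 *\<^sub>R ((1/2) *\<^sub>R (S *v v + v v* S)) = 2 *\<^sub>R (v v* S)" by (rule arg_cong)
      then show ?thesis by (simp add: scaleR_2)
    qed
    then have "S = transpose S" by (simp add: matrix_eq)
    then show ?thesis by (simp add: symmetric_mat_def S_def)
  qed
  ultimately show "?sym \<and> ?psd" by blast
next
  define S where "S = S_mat u \<sigma> x"
  assume "?sym \<and> ?psd"
  then have sym: "symmetric_mat S" and psd: "\<And>v. 0 \<le> v \<bullet> (S *v v)"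
    by (auto simp: S_def pos_semidef_def)
  show ?K
    unfolding pos_semidef_def
  proof
    fix z :: "real^('m+'m)"
    obtain v w where z: "z = vec_join v w" by (rule vec_join_cases)
    have "two_leg_form S v w = (v + w) \<bullet> (S *v (v + w))"
      using inner_symmetric_mat[OF sym, of v w]
      by (simp add: two_leg_form_def matrix_vector_right_distrib inner_add_left inner_add_right inner_commute)
    then show "0 \<le> z \<bullet> (K_mat u \<sigma> x *v z)"
      using psd unfolding z quadratic_form_K_mat S_def by simp
  qed
qed

section \<open>Continuously differentiable maps\<close>

lemma Ck_SucD: "Ck (Suc k) f \<Longrightarrow> Ck k f"
proof (induction k arbitrary: f)
  case 0
  then show ?case
    by (auto intro!: continuous_at_imp_continuous_on differentiable_imp_continuous_within)
next
  case (Suc k)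
  then show ?case by fastforce
qed

lemma Ck_1_I:
  assumes f': "\<And>x. (f has_derivative f' x) (at x)" and "\<And>v. continuous_on UNIV (\<lambda>x. f' x v)"
  shows "Ck (Suc 0) f"
proof -
  have "frechet_derivative f (at x) = f' x" for x
    using frechet_derivative_at[OF f'] by simp
  then show ?thesis using assms by (auto simp: differentiable_def)
qed

lemma Ck_1_has_derivative:
  "Ck (Suc 0) f \<Longrightarrow> (f has_derivative frechet_derivative f (at x)) (at x)"
  by (simp add: frechet_derivative_works[symmetric])

lemma Ck_1_continuous_derivative:
  assumes f: "Ck (Suc 0) f" and h: "continuous_on UNIV h"
  shows "continuous_on UNIV (\<lambda>x. frechet_derivative f (at x) (h x))"
proof -
  have "frechet_derivative f (at x) (h x) = (\<Sum>b\<in>Basis. (h x \<bullet> b) *\<^sub>R frechet_derivative f (at x) b)" for x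
  proof -
    interpret linear "frechet_derivative f (at x)"
      using Ck_1_has_derivative[OF f] by (rule has_derivative_linear)
    have "frechet_derivative f (at x) (h x) = frechet_derivative f (at x) (\<Sum>b\<in>Basis. (h x \<bullet> b) *\<^sub>R b)"
      by (simp add: euclidean_representation)
    then show ?thesis by (simp add: sum scaleR)
  qed
  then show ?thesis
    using f h by (auto intro!: continuous_intros)
qed

lemma Ck_1_bilinear:
  assumes mul: "bounded_bilinear mul" and f: "Ck (Suc 0) f" and g: "Ck (Suc 0) g"
  shows "Ck (Suc 0) (\<lambda>x. mul (f x) (g x))"
proof (rule Ck_1_I)
  show "((\<lambda>x. mul (f x) (g x)) has_derivative
      (\<lambda>h. mul (f x) (frechet_derivative g (at x) h) + mul (frechet_derivative f (at x) h) (g x))) (at x)" for x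
    by (intro bounded_bilinear.FDERIV[OF mul] Ck_1_has_derivative f g)
  show "continuous_on UNIV (\<lambda>x. mul (f x) (frechet_derivative g (at x) h)
      + mul (frechet_derivative f (at x) h) (g x))" for h
    using f g Ck_SucD[OF f] Ck_SucD[OF g]
    by (intro continuous_on_add bounded_bilinear.continuous_on[OF mul]) auto
qed

lemma Ck_const: "Ck k (\<lambda>_. c)"
  by (induction k arbitrary: c) auto

lemma Ck_1_sum:
  assumes f: "\<And>i. i \<in> I \<Longrightarrow> Ck (Suc 0) (f i)"
  shows "Ck (Suc 0) (\<lambda>x. \<Sum>i\<in>I. f i x)"
proof (rule Ck_1_I)
  show "((\<lambda>x. \<Sum>i\<in>I. f i x) has_derivative (\<lambda>h. \<Sum>i\<in>I. frechet_derivative (f i) (at x) h)) (at x)" for x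
    by (intro has_derivative_sum Ck_1_has_derivative f)
  show "continuous_on UNIV (\<lambda>x. \<Sum>i\<in>I. frechet_derivative (f i) (at x) h)" for h
    using f by (auto intro!: continuous_intros)
qed

text \<open>The sum of the norms of the partial derivatives bounds the operator norm of the derivative, and
it is a continuous function, hence bounded on the ball.\<close>

lemma Ck_1_lipschitz_on_cball:
  assumes f: "Ck (Suc 0) f"
  obtains L where "L-lipschitz_on (cball p r) f"
proof -
  define N where "N x = (\<Sum>b\<in>Basis. norm (frechet_derivative f (at x) b))" for x
  have "continuous_on (cball p r) N"
    unfolding N_def using f by (auto intro!: continuous_intros intro: continuous_on_subset)
  then have "bounded (N ` cball p r)"
    using compact_imp_bounded compact_continuous_image[OF _ compact_cball] by blast
  then obtain B where B: "0 < B" "\<And>x. x \<in> cball p r \<Longrightarrow> norm (N x) \<le> B"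
    by (auto simp: bounded_pos)
  have "B-lipschitz_on (cball p r) f"
  proof (rule lipschitz_onI)
    fix x y assume xy: "x \<in> cball p r" "y \<in> cball p r"
    have "norm (f x - f y) \<le> B * norm (x - y)"
    proof (rule differentiable_bound[OF convex_cball[of p r]])
      fix z assume z: "z \<in> cball p r"
      show "(f has_derivative frechet_derivative f (at z)) (at z within cball p r)"
        using Ck_1_has_derivative[OF f] by (rule has_derivative_at_withinI)
      have "onorm (frechet_derivative f (at z)) \<le> N z"
        unfolding N_def
        by (intro onorm_componentwise has_derivative_bounded_linear[OF Ck_1_has_derivative] f)
      then show "onorm (frechet_derivative f (at z)) \<le> B"
        using B(2)[OF z] by simp
    qed (use xy in auto)
    then show "dist (f x) (f y) \<le> B * dist x y" by (simp add: dist_norm)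
  qed (use B in simp)
  then show thesis ..
qed

lemma bounded_bilinear_matrix_vector_mult:
  "bounded_bilinear ((*v) :: real^'m^'n \<Rightarrow> real^'m \<Rightarrow> real^'n)"
  unfolding bilinear_conv_bounded_bilinear[symmetric] bilinear_def
  by (auto intro!: linearI simp: algebra_simps matrix_vector_mult_add_rdistrib matrix_vector_right_distrib
     matrix_vector_mult_scaleR scaleR_matrix_vector_assoc)

lemma bounded_bilinear_vector_matrix_mult:
  "bounded_bilinear ((v*) :: real^'n \<Rightarrow> real^'m^'n \<Rightarrow> real^'m)"
  unfolding bilinear_conv_bounded_bilinear[symmetric] bilinear_def
  by (auto intro!: linearI simp: vec_eq_iff vector_matrix_mult_def sum.distrib sum_distrib_left algebra_simps)

lemma Ck_1_grad:
  assumes u: "Ck 2 u"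
  shows "Ck (Suc 0) (grad u)"
proof -
  have "Ck (Suc 0) (\<lambda>x. \<Sum>k\<in>UNIV. frechet_derivative u (at x) (axis k 1) *\<^sub>R axis k (1::real))"
    using u unfolding numeral_2_eq_2
    by (intro Ck_1_sum Ck_1_bilinear[OF bounded_bilinear_scaleR] Ck_const) auto
  moreover have "grad u = (\<lambda>x. \<Sum>k\<in>UNIV. frechet_derivative u (at x) (axis k 1) *\<^sub>R axis k 1)"
    by (simp add: fun_eq_iff grad_def vec_eq_iff axis_def if_distrib cong: if_cong)
  ultimately show ?thesis by simp
qed

lemma Ck_1_grad_mult:
  assumes "Ck 2 u" and "Ck (Suc 0) \<sigma>"
  shows "Ck (Suc 0) (grad_mult u \<sigma>)"
  unfolding grad_mult_def[abs_def]
  by (intro Ck_1_bilinear[OF bounded_bilinear_vector_matrix_mult] Ck_1_grad assms)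

lemma frechet_derivative_grad:
  assumes "Ck (Suc 0) u"
  shows "frechet_derivative u (at x) h = grad u x \<bullet> h"
proof -
  interpret linear "frechet_derivative u (at x)"
    using Ck_1_has_derivative[OF assms] by (rule has_derivative_linear)
  have "frechet_derivative u (at x) h = frechet_derivative u (at x) (\<Sum>k\<in>UNIV. h $ k *\<^sub>R axis k 1)"
    using basis_expansion[of h] by (simp add: scalar_mult_eq_scaleR)
  then show ?thesis
    by (simp add: sum scaleR grad_def inner_vec_def mult.commute)
qed

text \<open>This is how \<open>S\<close> enters the dynamics: \<open>S v\<close> is the derivative of \<open>grad_mult u \<sigma>\<close> in the direction
in which the system moves under the constant control \<open>v\<close>.\<close>

lemma S_mat_mult:
  assumes "Ck (Suc 0) (grad_mult u \<sigma>)"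
  shows "S_mat u \<sigma> x *v v = frechet_derivative (grad_mult u \<sigma>) (at x) (\<sigma> x *v v)"
proof -
  have "grad_mult u \<sigma> differentiable (at x)" using assms by simp
  then have "frechet_derivative (grad_mult u \<sigma>) (at x) = (\<lambda>h. jacobian (grad_mult u \<sigma>) (at x) *v h)"
    by (metis frechet_derivative_at jacobian_works)
  then show ?thesis by (simp add: S_mat_def matrix_vector_mul_assoc)
qed

section \<open>Local existence of integral curves\<close>

definition integral_curve :: "('a::euclidean_space \<Rightarrow> 'a) \<Rightarrow> real \<Rightarrow> (real \<Rightarrow> 'a) \<Rightarrow> bool" where
  "integral_curve F h x \<longleftrightarrow> (\<forall>t\<in>{0..h}. (x has_vector_derivative F (x t)) (at t within {0..h}))"

lemma continuous_on_integral_curve: "integral_curve F h x \<Longrightarrow> continuous_on {0..h} x"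
  unfolding integral_curve_def continuous_on_eq_continuous_within
  using has_vector_derivative_continuous by blast

text \<open>Picard iteration. The iteration acts on bounded continuous functions on the whole line: outside
\<open>{0..h}\<close> the integral is continued by its values at the endpoints, so that the complete metric
of that function space is available. The condition \<open>h * L < 1\<close> makes one step a contraction.\<close>

lemma integral_curve_if_lipschitz:
  fixes F :: "'a::euclidean_space \<Rightarrow> 'a"
  assumes lip: "L-lipschitz_on UNIV F" and "0 \<le> h" and "h * L < 1"
  obtains x where "x 0 = x0" and "integral_curve F h x"
proof -
  have L: "0 \<le> L" using lip by (rule lipschitz_on_nonneg)
  have contF: "continuous_on UNIV F"
    using lip by (rule lipschitz_on_continuous_on)
  have contFx: "continuous_on {a..b} (\<lambda>r. F (apply_bcontfun x r))" for x :: "real \<Rightarrow>\<^sub>C 'a" and a b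
    by (rule continuous_on_compose2[OF contF]) auto
  define I where "I x t = x0 + integral {0..t} (\<lambda>r. F (apply_bcontfun x r))" for x :: "real \<Rightarrow>\<^sub>C 'a" and t :: real
  have "\<exists>y. (\<forall>t\<in>{0..h}. apply_bcontfun y t = I x t) \<and> (\<forall>t. apply_bcontfun y t = I x (clamp 0 h t))" for x
  proof -
    have "continuous_on {0..h} (I x)"
      unfolding I_def
      by (intro continuous_intros indefinite_integral_continuous_1 integrable_continuous_real contFx)
    then have "continuous_on (cbox 0 h) (I x)" by simp
    from continuous_on_cbox_bcontfunE[OF this] show ?thesis
      by (metis cbox_interval)
  qed
  then obtain P where P: "\<And>x t. t \<in> {0..h} \<Longrightarrow> apply_bcontfun (P x) t = I x t"
      and P': "\<And>x t. apply_bcontfun (P x) t = I x (clamp 0 h t)"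
    by metis
  have "dist (P x) (P y) \<le> (h * L) * dist x y" for x y
  proof (rule dist_bound)
    fix t
    define s where "s = clamp 0 h t"
    have s: "s \<in> {0..h}"
      using clamp_in_interval[of 0 h t] \<open>0 \<le> h\<close> by (simp add: s_def)
    have int: "(\<lambda>r. F (apply_bcontfun z r)) integrable_on {0..s}" for z
      by (intro integrable_continuous_real contFx)
    have "dist (P x t) (P y t) = norm (integral {0..s} (\<lambda>r. F (x r) - F (y r)))"
      by (simp add: P' I_def dist_norm integral_diff[OF int int] s_def[symmetric])
    also have "\<dots> \<le> (L * dist x y) * (s - 0)"
    proof (rule integral_bound)
      fix r
      have "norm (F (x r) - F (y r)) \<le> L * dist (x r) (y r)"
        using lipschitz_onD[OF lip] by (simp add: dist_norm)
      also have "\<dots> \<le> L * dist x y"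
        using L by (intro mult_left_mono dist_bounded)
      finally show "norm (F (x r) - F (y r)) \<le> L * dist x y" .
    qed (use s in \<open>auto intro!: continuous_intros contFx\<close>)
    also have "\<dots> \<le> (L * dist x y) * h"
      using s L by (intro mult_left_mono) auto
    finally show "dist (P x t) (P y t) \<le> (h * L) * dist x y" by (simp add: mult_ac)
  qed
  then obtain x where fixpoint: "P x = x"
    using banach_fix_type[of "h * L" P] L \<open>0 \<le> h\<close> \<open>h * L < 1\<close> by auto
  have x: "apply_bcontfun x t = I x t" if "t \<in> {0..h}" for t
    using P[OF that, of x] by (simp add: fixpoint)
  show thesis
  proof
    show "apply_bcontfun x 0 = x0"
      using x[of 0] \<open>0 \<le> h\<close> by (simp add: I_def)
    show "integral_curve F h (apply_bcontfun x)"
      unfolding integral_curve_def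
    proof
      fix t assume t: "t \<in> {0..h}"
      have "(I x has_vector_derivative F (x t)) (at t within {0..h})"
        unfolding I_def
        using has_vector_derivative_add[OF has_vector_derivative_const
          integral_has_vector_derivative[OF contFx t]] by simp
      then show "(apply_bcontfun x has_vector_derivative F (x t)) (at t within {0..h})"
        using t x by (rule has_vector_derivative_transform[rotated 2]) 
    qed
  qed
qed

text \<open>The time \<open>h\<close> depends on the two radii and the field only, which makes it uniform in the
starting point. On the ball \<open>F\<close> is bounded by some \<open>M\<close>, so a curve needs at least time
\<open>(R - r) / M\<close> to leave it.\<close>

lemma integral_curve_in_cball:
  fixes F :: "'a::euclidean_space \<Rightarrow> 'a"
  assumes lip: "L-lipschitz_on (cball p R) F"
    and "0 \<le> r" and "r < R"
  obtains h where "0 < h"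
    and "\<And>x0 s. \<lbrakk>x0 \<in> cball p r; 0 \<le> s; s \<le> h\<rbrakk> \<Longrightarrow>
           \<exists>x. x 0 = x0 \<and> integral_curve F s x \<and> (\<forall>t\<in>{0..s}. x t \<in> cball p R)"
proof -
  define B where "B = cball p R"
  have B: "convex B" "closed B" "B \<noteq> {}" "compact B"
    using \<open>0 \<le> r\<close> \<open>r < R\<close> by (auto simp: B_def)
  \<comment> \<open>Extending \<open>F\<close> by the nearest-point projection keeps the Lipschitz constant.\<close>
  define G where "G x = F (closest_point B x)" for x
  have GB: "G x = F x" if "x \<in> B" for x
    using that by (simp add: G_def closest_point_self)
  have L: "0 \<le> L" using lip by (rule lipschitz_on_nonneg)
  have inB: "closest_point B x \<in> B" for x
    using B by (intro closest_point_in_set) auto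
  have lipG: "L-lipschitz_on UNIV G"
  proof (rule lipschitz_onI)
    fix x y
    have "dist (G x) (G y) \<le> L * dist (closest_point B x) (closest_point B y)"
      unfolding G_def using lip inB unfolding B_def by (intro lipschitz_onD) auto
    also have "\<dots> \<le> L * dist x y"
      using L B by (intro mult_left_mono closest_point_lipschitz) auto
    finally show "dist (G x) (G y) \<le> L * dist x y" .
  qed (rule L)
  have "bounded (F ` B)"
    using lipschitz_on_continuous_on[OF lip] compact_imp_bounded compact_continuous_image[OF _ compact_cball] unfolding B_def by blast
  then obtain M where M: "0 < M" "\<And>x. x \<in> B \<Longrightarrow> norm (F x) \<le> M"
    by (auto simp: bounded_pos)
  have GM: "norm (G x) \<le> M" for x
    unfolding G_def by (rule M(2)[OF inB])
  define h where "h = min ((R - r) / M) (1 / (L + 1))"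
  have h: "0 < h" using M L \<open>r < R\<close> by (simp add: h_def)
  show thesis
  proof
    show "0 < h" by fact
  next
    fix x0 s assume x0: "x0 \<in> cball p r" and "0 \<le> s" "s \<le> h"
    have "s * L \<le> 1 / (L + 1) * L"
      using \<open>s \<le> h\<close> L by (intro mult_right_mono) (auto simp: h_def)
    also have "\<dots> < 1" using L by (simp add: field_simps)
    finally have "s * L < 1" .
    then obtain x where x: "x 0 = x0" "integral_curve G s x"
      using integral_curve_if_lipschitz[OF lipG \<open>0 \<le> s\<close>] by blast
    have inB: "x t \<in> B" if t: "t \<in> {0..s}" for t
    proof -
      have "norm (x t - x 0) \<le> M * norm (t - 0)"
      proof (rule differentiable_bound)
        fix \<tau> assume "\<tau> \<in> {0..s}"
        then show "(x has_derivative (\<lambda>e. e *\<^sub>R G (x \<tau>))) (at \<tau> within {0..s})"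
          using x(2) by (simp add: integral_curve_def has_vector_derivative_def)
        show "onorm (\<lambda>e. e *\<^sub>R G (x \<tau>)) \<le> M"
          by (intro onorm_le) (simp add: mult.commute[of M] mult_left_mono GM)
      qed (use t in auto)
      also have "\<dots> \<le> M * h"
        using t \<open>s \<le> h\<close> M by (intro mult_left_mono) auto
      also have "\<dots> \<le> M * ((R - r) / M)"
        using M by (intro mult_left_mono) (auto simp: h_def)
      also have "\<dots> = R - r" using M by simp
      finally have "dist (x 0) (x t) \<le> R - r" by (simp add: dist_norm norm_minus_commute)
      then show ?thesis
        using x0 x(1) dist_triangle[of p "x t" "x 0"] by (simp add: B_def)
    qed
    then have "integral_curve F s x"
      using x(2) by (simp add: integral_curve_def GB)
    then show "\<exists>x. x 0 = x0 \<and> integral_curve F s x \<and> (\<forall>t\<in>{0..s}. x t \<in> cball p R)"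
      using x(1) inB unfolding B_def by blast
  qed
qed

section \<open>Second-order growth along integral curves\<close>

text \<open>The function \<open>\<phi> t - k * t\<close> is nonincreasing. Only upper bounds on \<open>u\<close> matter for reaching a
sublevel set, hence the one-sided form of this estimate and the next.\<close>

lemma growth_le:
  fixes \<phi> :: "real \<Rightarrow> real"
  assumes der: "\<And>t. t \<in> {0..h} \<Longrightarrow> (\<phi> has_real_derivative \<phi>' t) (at t within {0..h})"
    and le: "\<And>t. t \<in> {0..h} \<Longrightarrow> \<phi>' t \<le> k" and t: "t \<in> {0..h}"
  shows "\<phi> t \<le> \<phi> 0 + k * t"
proof -
  have sub: "(\<phi> has_real_derivative \<phi>' \<tau>) (at \<tau> within {0..t})" if "\<tau> \<in> {0..t}" for \<tau>
    using that t by (intro DERIV_subset[OF der]) auto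
  have "\<phi> t - k * t \<le> \<phi> 0 - k * 0"
  proof (rule DERIV_nonpos_imp_decreasing_open[where f = "\<lambda>\<tau>. \<phi> \<tau> - k * \<tau>"])
    fix \<tau> assume \<tau>: "0 < \<tau>" "\<tau> < t"
    then have "(\<phi> has_real_derivative \<phi>' \<tau>) (at \<tau>)"
      using sub[of \<tau>] by (simp add: at_within_Icc_at)
    then have "((\<lambda>\<tau>. \<phi> \<tau> - k * \<tau>) has_real_derivative \<phi>' \<tau> - k) (at \<tau>)"
      by (auto intro!: derivative_eq_intros)
    moreover have "\<phi>' \<tau> - k \<le> 0" using le[of \<tau>] \<tau> t by simp
    ultimately show "\<exists>y. ((\<lambda>\<tau>. \<phi> \<tau> - k * \<tau>) has_real_derivative y) (at \<tau>) \<and> y \<le> 0" by blast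
  next
    have "continuous_on {0..t} \<phi>"
      using sub by (meson DERIV_continuous_on)
    then show "continuous_on {0..t} (\<lambda>\<tau>. \<phi> \<tau> - k * \<tau>)"
      by (intro continuous_intros)
  qed (use t in auto)
  then show ?thesis by simp
qed

lemma second_order_growth_le:
  fixes \<phi> :: "real \<Rightarrow> real"
  assumes der: "\<And>t. t \<in> {0..h} \<Longrightarrow> (\<phi> has_real_derivative \<phi>' t) (at t within {0..h})"
    and der': "\<And>t. t \<in> {0..h} \<Longrightarrow> (\<phi>' has_real_derivative \<phi>'' t) (at t within {0..h})"
    and le: "\<And>t. t \<in> {0..h} \<Longrightarrow> \<phi>'' t \<le> k" and t: "t \<in> {0..h}"
  shows "\<phi> t \<le> \<phi> 0 + t * \<phi>' 0 + t\<^sup>2 / 2 * k"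
proof -
  define \<psi> where "\<psi> t = \<phi> t - \<phi>' 0 * t - t\<^sup>2 / 2 * k" for t
  have "\<psi> t \<le> \<psi> 0 + 0 * t"
  proof (rule growth_le)
    fix \<tau> assume \<tau>: "\<tau> \<in> {0..h}"
    show "(\<psi> has_real_derivative \<phi>' \<tau> - \<phi>' 0 - k * \<tau>) (at \<tau> within {0..h})"
      unfolding \<psi>_def[abs_def] using der[OF \<tau>] by (auto intro!: derivative_eq_intros)
    show "\<phi>' \<tau> - \<phi>' 0 - k * \<tau> \<le> 0"
      using growth_le[OF der' le \<tau>] by simp
  qed (rule t)
  then show ?thesis by (simp add: \<psi>_def algebra_simps)
qed

lemma has_vector_derivative_along_integral_curve:
  assumes "Ck (Suc 0) f" and "integral_curve F h x" and "t \<in> {0..h}"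
  shows "((\<lambda>t. f (x t)) has_vector_derivative frechet_derivative f (at (x t)) (F (x t)))
    (at t within {0..h})"
proof -
  have "(x has_derivative (\<lambda>e. e *\<^sub>R F (x t))) (at t within {0..h})"
    using assms by (simp add: integral_curve_def has_vector_derivative_def)
  from has_derivative_compose[OF this Ck_1_has_derivative[OF assms(1)]]
  show ?thesis
    by (simp add: has_vector_derivative_def
      linear_cmul[OF has_derivative_linear[OF Ck_1_has_derivative[OF assms(1)]]])
qed

text \<open>Along the constant control \<open>v\<close> the first derivative of \<open>u\<close> is \<open>v \<bullet> grad_mult u \<sigma>\<close>, and the derivative
of \<open>w \<bullet> grad_mult u \<sigma>\<close> is \<open>w \<bullet> (S v)\<close>. Taking \<open>w = v\<close> bounds the second derivative of \<open>u\<close>; with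
\<open>w\<close> the next control, the first claim follows the slope with which the next leg will start.\<close>

lemma integral_curve_second_order_le:
  fixes u :: "real^'n \<Rightarrow> real" and \<sigma> :: "real^'n \<Rightarrow> real^'m^'n"
  assumes u: "Ck 2 u" and \<sigma>: "Ck (Suc 0) \<sigma>"
    and leg: "integral_curve (\<lambda>z. \<sigma> z *v v) h x"
    and in_U: "\<And>t. t \<in> {0..h} \<Longrightarrow> x t \<in> U" and "0 \<le> h"
  shows grad_mult_leg_le: "(\<And>z. z \<in> U \<Longrightarrow> w \<bullet> (S_mat u \<sigma> z *v v) \<le> k) \<Longrightarrow>
      w \<bullet> grad_mult u \<sigma> (x h) \<le> w \<bullet> grad_mult u \<sigma> (x 0) + k * h"
    and value_leg_le: "(\<And>z. z \<in> U \<Longrightarrow> v \<bullet> (S_mat u \<sigma> z *v v) \<le> k) \<Longrightarrow>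
      u (x h) \<le> u (x 0) + h * (v \<bullet> grad_mult u \<sigma> (x 0)) + h\<^sup>2 / 2 * k"
proof -
  have u1: "Ck (Suc 0) u" using u Ck_SucD by (metis numeral_2_eq_2)
  have g: "Ck (Suc 0) (grad_mult u \<sigma>)" using u \<sigma> by (rule Ck_1_grad_mult)
  have der': "((\<lambda>t. w \<bullet> grad_mult u \<sigma> (x t)) has_real_derivative w \<bullet> (S_mat u \<sigma> (x t) *v v))
      (at t within {0..h})" if t: "t \<in> {0..h}" for t w
    using has_vector_derivative_along_integral_curve[OF g leg t]
    by (auto intro!: derivative_eq_intros simp: S_mat_mult[OF g] has_real_derivative_iff_has_vector_derivative
      has_vector_derivative_def)
  have "v \<bullet> grad_mult u \<sigma> z = frechet_derivative u (at z) (\<sigma> z *v v)" for z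
    by (metis frechet_derivative_grad[OF u1] dot_lmul_matrix grad_mult_def inner_commute)
  then have der: "((\<lambda>t. u (x t)) has_real_derivative v \<bullet> grad_mult u \<sigma> (x t)) (at t within {0..h})"
    if t: "t \<in> {0..h}" for t
    using has_vector_derivative_along_integral_curve[OF u1 leg t]
    by (simp add: has_real_derivative_iff_has_vector_derivative)
  show "w \<bullet> grad_mult u \<sigma> (x h) \<le> w \<bullet> grad_mult u \<sigma> (x 0) + k * h"
    if "\<And>z. z \<in> U \<Longrightarrow> w \<bullet> (S_mat u \<sigma> z *v v) \<le> k"
    by (rule growth_le[OF der']) (use that in_U \<open>0 \<le> h\<close> in auto)
  show "u (x h) \<le> u (x 0) + h * (v \<bullet> grad_mult u \<sigma> (x 0)) + h\<^sup>2 / 2 * k"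
    if "\<And>z. z \<in> U \<Longrightarrow> v \<bullet> (S_mat u \<sigma> z *v v) \<le> k"
    by (rule second_order_growth_le[OF der der']) (use that in_U \<open>0 \<le> h\<close> in auto)
qed

section \<open>Concatenation of solutions\<close>

text \<open>Resting at a point gives a solution on \<open>{0..}\<close>, onto which finitely many legs can be prepended.\<close>

lemma is_solution_rest:
  assumes "f p 0 = 0"
  shows "is_control (\<lambda>_. 0)" and "is_solution f (\<lambda>_. 0) {0..} (\<lambda>_. p)"
  using assms
  by (auto simp: is_control_def is_solution_def is_interval_ci constant_on_def intro!: exI[of _ "{}"])

text \<open>A solution on all of \<open>{0..}\<close> cannot be extended, so it is a trajectory. This is why the legs below
are followed by rest.\<close>

lemma reach_withinI:
  assumes a: "is_control a" and x: "is_solution f a {0..} x"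
    and "0 \<le> s" "s < t" "x s \<in> T"
  shows "x 0 \<in> reach_within f T t"
proof -
  have "is_trajectory f a {0..} x"
    using x by (auto simp: is_trajectory_def is_solution_def)
  then show ?thesis
    using assms by (auto simp: reach_within_def)
qed

text \<open>Past time \<open>s\<close> the new control and solution are time shifts of the old ones; the junction is added to
the exceptional times, so only continuity has to be matched there.\<close>

lemma solution_prepend_leg:
  assumes b: "is_control b" and y: "is_solution f b {0..} y"
    and v: "norm v \<le> 1" and "0 \<le> s" and leg: "integral_curve (\<lambda>z. f z v) s x" and join: "x s = y 0"
  obtains a z where "is_control a" and "is_solution f a {0..} z"
    and "z 0 = x 0" and "\<And>t. 0 \<le> t \<Longrightarrow> z (s + t) = y t"
proof -
  define a where "a t = (if t < s then v else b (t - s))" for t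
  define z where "z t = (if t \<le> s then x t else y (t - s))" for t
  have "is_control a"
    unfolding is_control_def
  proof (intro conjI allI impI)
    fix t :: real assume "0 \<le> t"
    then show "a t \<in> cball 0 1"
      using b v by (auto simp: a_def is_control_def)
  next
    fix T :: real assume "0 \<le> T"
    then obtain P where P: "finite P" "\<And>I. is_interval I \<Longrightarrow> I \<subseteq> {0..T} - P \<Longrightarrow> b constant_on I"
      using b by (meson is_control_def)
    show "\<exists>P. finite P \<and> (\<forall>I. is_interval I \<and> I \<subseteq> {0..T} - P \<longrightarrow> a constant_on I)"
    proof (intro exI[of _ "insert s ((+) s ` P)"] conjI allI impI)
      fix I assume I: "is_interval I \<and> I \<subseteq> {0..T} - insert s ((+) s ` P)"
      then have "s \<notin> I" by auto
      then have "(\<forall>t\<in>I. t < s) \<or> (\<forall>t\<in>I. s < t)"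
        using I mem_is_interval_1_I[of I _ _ s] by (meson not_less)
      then show "a constant_on I"
      proof
        assume "\<forall>t\<in>I. t < s"
        then show ?thesis by (auto simp: constant_on_def a_def)
      next
        assume s: "\<forall>t\<in>I. s < t"
        have "b constant_on ((\<lambda>t. t - s) ` I)"
        proof (rule P(2))
          show "is_interval ((\<lambda>t. t - s) ` I)"
            using I by simp
          show "(\<lambda>t. t - s) ` I \<subseteq> {0..T} - P"
          proof safe
            fix t assume t: "t \<in> I"
            then have "t \<in> {0..T}" "t \<notin> (+) s ` P" "s < t" using I s by auto
            then show "t - s \<in> {0..T}" using \<open>0 \<le> s\<close> by auto
            assume "t - s \<in> P"
            then have "s + (t - s) \<in> (+) s ` P" by (rule imageI)
            then show False using \<open>t \<notin> (+) s ` P\<close> by simp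
          qed
        qed
        then show ?thesis using s by (fastforce simp: constant_on_def a_def)
      qed
    qed (use P in simp)
  qed
  moreover have "is_solution f a {0..} z"
    unfolding is_solution_def
  proof (intro conjI allI impI)
    have y_cont: "continuous_on {0..} y"
      using y by (simp add: is_solution_def)
    show "continuous_on {0..} z"
      unfolding z_def
    proof (rule continuous_on_cases_le)
      show "continuous_on {t \<in> {0..}. t \<le> s} x"
        using continuous_on_integral_curve[OF leg] by (rule continuous_on_subset) auto
      show "continuous_on {t \<in> {0..}. s \<le> t} (\<lambda>t. y (t - s))"
        by (rule continuous_on_compose2[OF y_cont]) (auto intro!: continuous_intros)
    qed (use join in auto)
  next
    fix T :: real assume "0 \<le> T"
    then obtain P where P: "finite P"
        "\<And>t. t \<in> {0..} \<inter> {0..T} - P \<Longrightarrow> (y has_vector_derivative f (y t) (b t)) (at t within {0..})"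
      using y by (meson is_solution_def)
    show "\<exists>P. finite P \<and> (\<forall>t\<in>{0..} \<inter> {0..T} - P.
        (z has_vector_derivative f (z t) (a t)) (at t within {0..}))"
    proof (intro exI[of _ "insert 0 (insert s ((+) s ` P))"] conjI ballI)
      fix t assume t: "t \<in> {0..} \<inter> {0..T} - insert 0 (insert s ((+) s ` P))"
      have "(z has_vector_derivative f (z t) (a t)) (at t)"
      proof (cases "t < s")
        case True
        have "(x has_vector_derivative f (x t) v) (at t within {0..s})"
          using leg t True by (simp add: integral_curve_def)
        then have "(x has_vector_derivative f (z t) (a t)) (at t)"
          using t True by (simp add: at_within_Icc_at z_def a_def)
        then show ?thesis
          by (rule has_vector_derivative_transform_within_open[where S = "{..<s}"])
            (use True in \<open>auto simp: z_def\<close>)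
      next
        case False
        then have st: "s < t" and "t - s \<in> {0..} \<inter> {0..T} - P"
          using t \<open>0 \<le> s\<close> imageI[of "t - s" P "(+) s"] by auto
        then have "(y has_vector_derivative f (y (t - s)) (b (t - s))) (at (t - s) within {0..})"
          by (intro P)
        then have "(y has_vector_derivative f (y (t - s)) (b (t - s))) (at (t - s))"
          using st at_within_interior[of "t - s" "{0..}"] by simp
        then have "((\<lambda>t. y (t - s)) has_vector_derivative f (z t) (a t)) (at t)"
          using st vector_diff_chain_at[of "\<lambda>t. t - s" 1 t y]
          by (simp add: o_def has_vector_derivative_diff_const z_def a_def)
        then show ?thesis
          by (rule has_vector_derivative_transform_within_open[where S = "{s<..}"])
            (use st in \<open>auto simp: z_def\<close>)
      qed
      then show "(z has_vector_derivative f (z t) (a t)) (at t within {0..})"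
        by (rule has_vector_derivative_at_within)
    qed (use P in simp)
  qed (auto simp: is_interval_ci)
  moreover have "z 0 = x 0" using \<open>0 \<le> s\<close> by (simp add: z_def)
  moreover have "z (s + t) = y t" if "0 \<le> t" for t
    using that join by (auto simp: z_def)
  ultimately show thesis ..
qed

lemma two_legs_reach:
  assumes v: "norm v \<le> 1" and w: "norm w \<le> 1" and "0 \<le> s" and "2 * s < t"
    and x: "integral_curve (\<lambda>z. f z v) s x" and y: "integral_curve (\<lambda>z. f z w) s y" and join: "x s = y 0"
    and rest: "f (y s) 0 = 0" and T: "y s \<in> T"
  shows "x 0 \<in> reach_within f T t"
proof -
  obtain b y' where b: "is_control b" "is_solution f b {0..} y'" "y' 0 = y 0"
      and y': "\<And>r. 0 \<le> r \<Longrightarrow> y' (s + r) = y s"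
    using solution_prepend_leg[OF is_solution_rest(1) is_solution_rest(2)[where f = f and p = "y s", OF rest] w \<open>0 \<le> s\<close> y refl]
    by blast
  obtain a z where a: "is_control a" "is_solution f a {0..} z" "z 0 = x 0"
      and z: "\<And>r. 0 \<le> r \<Longrightarrow> z (s + r) = y' r"
    using solution_prepend_leg[OF b(1,2) v \<open>0 \<le> s\<close> x] join b(3) by metis
  have "z (s + s) = y s"
    using z[of s] y'[of 0] \<open>0 \<le> s\<close> by simp
  then have "z 0 \<in> reach_within f T t"
    using assms a by (intro reach_withinI[where s = "s + s"]) auto
  then show ?thesis by (simp add: a)
qed

section \<open>Attainability\<close>

text \<open>Choose a pair \<open>(v, w)\<close> of controls in the unit ball at which the form of \<open>K\<close> has a value \<open>q < 0\<close>.
Applying \<open>v\<close> and then \<open>w\<close>, each for time \<open>s\<close>, to a point \<open>x0\<close> near \<open>p\<close> leads to a value of \<open>u\<close> of at most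
\<open>u x0 + s * ((v + w) \<bullet> grad_mult u \<sigma> x0) + s\<^sup>2 / 4 * q\<close>: the exact second-order coefficient \<open>q / 2\<close> at \<open>p\<close>
leaves room \<open>- q / 4\<close> for the oscillation of \<open>S\<close> over a ball. For a fixed small \<open>s\<close> this bound is
continuous in \<open>x0\<close>, and at \<open>p\<close> it equals \<open>u p + s\<^sup>2 / 4 * q < u p\<close>.\<close>

lemma STLA_if_not_pos_semidef:
  fixes \<sigma> :: "real^'n \<Rightarrow> real^'m^'n" and u :: "real^'n \<Rightarrow> real"
  assumes \<sigma>: "Ck (Suc 0) \<sigma>" and u: "Ck 2 u"
    and crit: "grad_mult u \<sigma> p = 0"
    and K: "\<not> pos_semidef (K_mat u \<sigma> p)"
  shows "STLA (\<lambda>x a. \<sigma> x *v a) {x. u x \<le> u p} p"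
proof -
  define S where "S = S_mat u \<sigma>"
  define g where "g = grad_mult u \<sigma>"
  have g: "Ck (Suc 0) g" unfolding g_def using u \<sigma> by (rule Ck_1_grad_mult)
  have u_cont: "continuous_on UNIV u"
    using u Ck_SucD by (metis numeral_2_eq_2 Ck.simps(1))
  have g_cont: "continuous_on UNIV g"
    using Ck_SucD[OF g] by simp
  have field: "Ck (Suc 0) (\<lambda>x. \<sigma> x *v a)" for a
    by (intro Ck_1_bilinear[OF bounded_bilinear_matrix_vector_mult] \<sigma> Ck_const)
  have S_cont: "continuous_on UNIV (\<lambda>x. b \<bullet> (S x *v a))" for a b
    using Ck_1_continuous_derivative[OF g, of "\<lambda>x. \<sigma> x *v a"] Ck_SucD[OF field]
    by (auto intro!: continuous_intros simp: S_def S_mat_mult[OF g[unfolded g_def]] g_def)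

  obtain z where z: "z \<bullet> (K_mat u \<sigma> p *v z) < 0"
    using K by (auto simp: pos_semidef_def not_le)
  obtain v0 w0 where z_eq: "z = vec_join v0 w0" by (rule vec_join_cases)
  \<comment> \<open>Scaling brings both controls into the unit ball and keeps the sign of the form.\<close>
  define c where "c = 1 / (1 + norm v0 + norm w0)"
  have c: "0 < c" by (simp add: c_def add_pos_nonneg)
  define v w where "v = c *\<^sub>R v0" and "w = c *\<^sub>R w0"
  have norm: "norm v \<le> 1" "norm w \<le> 1"
    by (auto simp: v_def w_def c_def field_simps add_pos_nonneg)
  define q where "q = two_leg_form (S p) v w"
  have "q = c\<^sup>2 * two_leg_form (S p) v0 w0"
    by (simp add: q_def two_leg_form_def v_def w_def matrix_vector_mult_scaleR power2_eq_square algebra_simps)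
  moreover have "two_leg_form (S p) v0 w0 < 0"
    using z by (simp add: z_eq quadratic_form_K_mat S_def)
  ultimately have q: "q < 0" using c by (simp add: mult_pos_neg)

  \<comment> \<open>The error \<open>\<eta>\<close> occurs four times in the form, and \<open>q + 4 * \<eta> = q / 2\<close>.\<close>
  define \<eta> where "\<eta> = - q / 8"
  have \<eta>: "0 < \<eta>" using q by (simp add: \<eta>_def)
  have near: "eventually (\<lambda>x. b \<bullet> (S x *v a) \<le> b \<bullet> (S p *v a) + \<eta>) (nhds p)" for a b
  proof -
    have "((\<lambda>x. b \<bullet> (S x *v a)) \<longlongrightarrow> b \<bullet> (S p *v a)) (nhds p)"
      using S_cont[of b a] by (simp add: continuous_on_eq_continuous_at isCont_def tendsto_nhds_iff)
    then have "eventually (\<lambda>x. b \<bullet> (S x *v a) < b \<bullet> (S p *v a) + \<eta>) (nhds p)"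
      using \<eta> by (intro order_tendstoD) auto
    then show ?thesis by eventually_elim simp
  qed
  have "eventually (\<lambda>x. v \<bullet> (S x *v v) \<le> v \<bullet> (S p *v v) + \<eta> \<and> w \<bullet> (S x *v w) \<le> w \<bullet> (S p *v w) + \<eta>
      \<and> w \<bullet> (S x *v v) \<le> w \<bullet> (S p *v v) + \<eta>) (nhds p)"
    by (intro eventually_conj near)
  then obtain R where "0 < R" and R': "\<And>x. dist x p < R \<Longrightarrow> v \<bullet> (S x *v v) \<le> v \<bullet> (S p *v v) + \<eta>
      \<and> w \<bullet> (S x *v w) \<le> w \<bullet> (S p *v w) + \<eta> \<and> w \<bullet> (S x *v v) \<le> w \<bullet> (S p *v v) + \<eta>"
    by (auto simp: eventually_nhds_metric)
  \<comment> \<open>Start within \<open>r\<close>, stay within \<open>2 * r\<close> on the first leg and within \<open>3 * r < R\<close> on the second.\<close>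
  define r where "r = R / 4"
  have r: "0 < r" using \<open>0 < R\<close> by (simp add: r_def)
  have R: "v \<bullet> (S x *v v) \<le> v \<bullet> (S p *v v) + \<eta>" "w \<bullet> (S x *v w) \<le> w \<bullet> (S p *v w) + \<eta>"
      "w \<bullet> (S x *v v) \<le> w \<bullet> (S p *v v) + \<eta>" if "x \<in> cball p (3 * r)" for x
    using R'[of x] that \<open>0 < R\<close> by (auto simp: r_def dist_commute)

  have legs: "\<exists>h>0. \<forall>x0\<in>cball p \<rho>. \<forall>s. 0 \<le> s \<longrightarrow> s \<le> h \<longrightarrow>
      (\<exists>x. x 0 = x0 \<and> integral_curve (\<lambda>z. \<sigma> z *v a) s x \<and> (\<forall>t\<in>{0..s}. x t \<in> cball p \<rho>'))"
    if \<rho>: "0 \<le> \<rho>" "\<rho> < \<rho>'" for a \<rho> \<rho>'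
  proof -
    obtain L where L: "L-lipschitz_on (cball p \<rho>') (\<lambda>z. \<sigma> z *v a)"
      using Ck_1_lipschitz_on_cball[OF field] by blast
    show ?thesis
      using integral_curve_in_cball[OF L \<rho>] by metis
  qed
  have radii: "0 \<le> r" "r < 2 * r" "0 \<le> 2 * r" "2 * r < 3 * r" using r by auto
  from legs[OF radii(1,2), of v] obtain h1 where "0 < h1"
    and h1: "\<forall>x0\<in>cball p r. \<forall>s. 0 \<le> s \<longrightarrow> s \<le> h1 \<longrightarrow>
      (\<exists>x. x 0 = x0 \<and> integral_curve (\<lambda>z. \<sigma> z *v v) s x \<and> (\<forall>t\<in>{0..s}. x t \<in> cball p (2 * r)))"
    by (elim exE conjE) (rule that)
  from legs[OF radii(3,4), of w] obtain h2 where "0 < h2"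
    and h2: "\<forall>x0\<in>cball p (2 * r). \<forall>s. 0 \<le> s \<longrightarrow> s \<le> h2 \<longrightarrow>
      (\<exists>x. x 0 = x0 \<and> integral_curve (\<lambda>z. \<sigma> z *v w) s x \<and> (\<forall>t\<in>{0..s}. x t \<in> cball p (3 * r)))"
    by (elim exE conjE) (rule that)

  have "p \<in> interior (reach_within (\<lambda>x a. \<sigma> x *v a) {x. u x \<le> u p} t)" if t: "0 < t" for t
  proof -
    define s where "s = min (t / 3) (min h1 h2)"
    have s: "0 < s" "2 * s < t" "s \<le> h1" "s \<le> h2"
      using t \<open>0 < h1\<close> \<open>0 < h2\<close> by (auto simp: s_def min_def)
    define bound where "bound x0 = u x0 + s * ((v + w) \<bullet> g x0) + s\<^sup>2 / 4 * q" for x0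
    have "continuous_on UNIV bound"
      unfolding bound_def using u_cont g_cont by (intro continuous_intros)
    then have "(bound \<longlongrightarrow> bound p) (nhds p)"
      by (simp add: continuous_on_eq_continuous_at isCont_def tendsto_nhds_iff)
    moreover have "bound p < u p"
      using s q crit by (simp add: bound_def g_def mult_pos_neg)
    ultimately have "eventually (\<lambda>x0. bound x0 < u p) (nhds p)"
      by (rule order_tendstoD)
    moreover have "eventually (\<lambda>x0. x0 \<in> cball p r) (nhds p)"
      using r by (intro eventually_nhds_in_nhd) simp
    ultimately have "eventually (\<lambda>x0. x0 \<in> reach_within (\<lambda>x a. \<sigma> x *v a) {x. u x \<le> u p} t) (nhds p)"
    proof eventually_elim
      case (elim x0)
      obtain x where x: "x 0 = x0" "integral_curve (\<lambda>z. \<sigma> z *v v) s x" "\<And>t. t \<in> {0..s} \<Longrightarrow> x t \<in> cball p (2 * r)"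
        using h1[rule_format, OF elim(2), of s] s by auto
      have "x s \<in> cball p (2 * r)" using x(3) s by simp
      then obtain y where y: "y 0 = x s" "integral_curve (\<lambda>z. \<sigma> z *v w) s y" "\<And>t. t \<in> {0..s} \<Longrightarrow> y t \<in> cball p (3 * r)"
        using h2[rule_format, of "x s" s] s by auto
      have x': "x t \<in> cball p (3 * r)" if "t \<in> {0..s}" for t
        using x(3)[OF that] r by simp
      note taylor = value_leg_le[OF u \<sigma>, folded S_def g_def] grad_mult_leg_le[OF u \<sigma>, folded S_def g_def]
      have "u (x s) \<le> u x0 + s * (v \<bullet> g x0) + s\<^sup>2 / 2 * (v \<bullet> (S p *v v) + \<eta>)"
        using taylor(1)[OF x(2) x' _ R(1)] s x(1) by simp
      moreover have "u (y s) \<le> u (x s) + s * (w \<bullet> g (x s)) + s\<^sup>2 / 2 * (w \<bullet> (S p *v w) + \<eta>)"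
        using taylor(1)[OF y(2,3) _ R(2)] s y(1) by simp
      moreover have "s * (w \<bullet> g (x s)) \<le> s * (w \<bullet> g x0 + (w \<bullet> (S p *v v) + \<eta>) * s)"
        using taylor(2)[OF x(2) x' _ R(3)] s x(1) by (intro mult_left_mono) auto
      ultimately have "u (y s) \<le> u x0 + s * (v \<bullet> g x0) + s\<^sup>2 / 2 * (v \<bullet> (S p *v v) + \<eta>)
          + s * (w \<bullet> g x0 + (w \<bullet> (S p *v v) + \<eta>) * s) + s\<^sup>2 / 2 * (w \<bullet> (S p *v w) + \<eta>)"
        by linarith
      also have "\<dots> = u x0 + s * ((v + w) \<bullet> g x0) + s\<^sup>2 / 2 * (q + 4 * \<eta>)"
        by (simp add: q_def two_leg_form_def inner_add_left power2_eq_square algebra_simps)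
      also have "\<dots> = bound x0"
        by (simp add: bound_def \<eta>_def)
      finally have "y s \<in> {x. u x \<le> u p}" using elim(1) by simp
      with two_legs_reach[where f = "\<lambda>x a. \<sigma> x *v a", OF norm _ s(2) x(2) y(2)] s x(1) y(1)
      show ?case by simp
    qed
    then show ?thesis
      by (auto simp: interior_def eventually_nhds)
  qed
  then show ?thesis by (simp add: STLA_def)
qed

theorem theorem4p6:
  fixes \<sigma> :: "real^'n \<Rightarrow> real^'m^'n"
    and u :: "real^'n \<Rightarrow> real"
    and xbar :: "real^'n"
  assumes "Ck 2 \<sigma>"
    and "Ck 3 u"
    and "grad u xbar \<noteq> 0"
    and "grad_mult u \<sigma> xbar = 0"
  shows "(pos_semidef (K_mat u \<sigma> xbar) \<longleftrightarrow>
            symmetric_mat (S_mat u \<sigma> xbar) \<and> pos_semidef (S_mat u \<sigma> xbar)) \<and>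
         (\<not> (symmetric_mat (S_mat u \<sigma> xbar) \<and> pos_semidef (S_mat u \<sigma> xbar)) \<longrightarrow>
            (\<exists>l<0. is_eigenvalue (K_mat u \<sigma> xbar) l) \<and>
            STLA (\<lambda>x a. \<sigma> x *v a) {x. u x \<le> u xbar} xbar)"
proof -
  have "Ck (Suc 0) \<sigma>" "Ck 2 u"
    using assms(1,2) Ck_SucD by (metis numeral_2_eq_2, metis numeral_3_eq_3 numeral_2_eq_2)
  then have "STLA (\<lambda>x a. \<sigma> x *v a) {x. u x \<le> u xbar} xbar" if "\<not> pos_semidef (K_mat u \<sigma> xbar)"
    using assms(4) that by (rule STLA_if_not_pos_semidef)
  then show ?thesis
    unfolding pos_semidef_K_mat_iff[symmetric]
    using negative_eigenvalue[OF symmetric_K_mat] by blast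
qed

end
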